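(* Let $\mathcal{C}$ be a $d$-uniform clutter without isolated vertices on the finite vertex set $X=\{x_1,\ldots,x_n\}$, with incidence matrix $A$. Assume that $\mathcal{C}$ has a perfect matching and that the set covering polyhedron $Q(A)=\{x\in\mathbb{R}^n\mid x\geq 0;\ xA\geq\mathbf{1}\}$ is integral. Then $\mathcal{C}$ is vertex critical, i.e. $\alpha_0(\mathcal{C}\setminus\{x_i\})<\alpha_0(\mathcal{C})$ for all $i$.
   Context: A clutter with finite vertex set $X$ is a family of subsets of $X$ (edges), none of which is included in another. It is $d$-uniform if all edges have exactly $d$ vertices ($d\geq 1$). A vertex is isolated if it lies in no edge. The incidence matrix is the vertex-edge $\{0,1\}$-matrix whose columns are the characteristic vectors of the edges. A perfect matching is a set of pairwise disjoint edges whose union is $X$. A polyhedron is integral if all its vertices are integral. $\mathbf{1}$ is the all-ones vector. A vertex cover of $\mathcal{C}$ is a subset of $X$ meeting every edge; $\alpha_0(\mathcal{C})$ is the smallest number of vertices in a vertex cover of $\mathcal{C}$. $\mathcal{C}\setminus\{x_i\}$ is the clutter obtained by deleting the vertex $x_i$ and removing all edges containing $x_i$. *)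

theory Defs
  imports "HOL-Analysis.Analysis"
begin

datatype 'a hypergraph = Hypergraph (verts: "'a set") (edges: "'a set set")

definition clutter :: "'a hypergraph \<Rightarrow> bool" where
  "clutter C \<longleftrightarrow> finite (verts C) \<and> (\<forall>e\<in>edges C. e \<subseteq> verts C) \<and>
     (\<forall>e\<in>edges C. \<forall>f\<in>edges C. e \<subseteq> f \<longrightarrow> e = f)"

definition uniform :: "nat \<Rightarrow> 'a hypergraph \<Rightarrow> bool" where
  "uniform d C \<longleftrightarrow> (\<forall>e\<in>edges C. card e = d)"

definition isolated :: "'a hypergraph \<Rightarrow> 'a \<Rightarrow> bool" where
  "isolated C v \<longleftrightarrow> v \<in> verts C \<and> (\<forall>e\<in>edges C. v \<notin> e)"

definition perfect_matching :: "'a hypergraph \<Rightarrow> 'a set set \<Rightarrow> bool" where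
  "perfect_matching C M \<longleftrightarrow> M \<subseteq> edges C \<and> pairwise disjnt M \<and> \<Union>M = verts C"

definition vertex_cover :: "'a hypergraph \<Rightarrow> 'a set \<Rightarrow> bool" where
  "vertex_cover C U \<longleftrightarrow> U \<subseteq> verts C \<and> (\<forall>e\<in>edges C. U \<inter> e \<noteq> {})"

text \<open>A cover exists whenever no edge is empty (take all vertices), so the minimum is attained
  for the clutters of interest and for their vertex deletions.\<close>

definition cover_number :: "'a hypergraph \<Rightarrow> nat" where
  "cover_number C = (LEAST k. \<exists>U. vertex_cover C U \<and> card U = k)"

definition delete_vertex :: "'a hypergraph \<Rightarrow> 'a \<Rightarrow> 'a hypergraph" where
  "delete_vertex C v = Hypergraph (verts C - {v}) {e \<in> edges C. v \<notin> e}"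

definition vertex_critical :: "'a hypergraph \<Rightarrow> bool" where
  "vertex_critical C \<longleftrightarrow> (\<forall>v\<in>verts C. cover_number (delete_vertex C v) < cover_number C)"

text \<open>Vertices and edges are listed by \<open>x\<close> and \<open>f\<close>; rows of the matrix are indexed by vertices,
  columns by edges.\<close>

definition incidence_matrix :: "('n::finite \<Rightarrow> 'a) \<Rightarrow> ('q::finite \<Rightarrow> 'a set) \<Rightarrow> real ^ 'q ^ 'n" where
  "incidence_matrix x f = (\<chi> i j. if x i \<in> f j then 1 else 0)"

text \<open>The order on vectors is componentwise and \<open>1\<close> is the all-ones vector.\<close>

definition set_covering_polyhedron :: "real ^ 'q::finite ^ 'n::finite \<Rightarrow> (real ^ 'n) set" where
  "set_covering_polyhedron A = {x. 0 \<le> x \<and> 1 \<le> x v* A}"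

text \<open>The vertices of a polyhedron are its extreme points.\<close>

definition integral_polyhedron :: "(real ^ 'n::finite) set \<Rightarrow> bool" where
  "integral_polyhedron P \<longleftrightarrow> (\<forall>v. v extreme_point_of P \<longrightarrow> (\<forall>i. v $ i \<in> \<int>))"

end

theory Submission
  imports Defs
begin

text \<open>Let \<open>M\<close> be a perfect matching. Summing the covering inequalities over \<open>M\<close> shows that the
  coordinate sum is at least \<open>card M\<close> on \<open>Q(A)\<close>, so the points with sum \<open>card M\<close> form a compact face,
  and by uniformity it contains \<open>(1/d, \<dots>, 1/d)\<close>. By Krein--Milman that point is a
  convex combination of extreme points of the face, hence every coordinate is nonzero at one of them.
  These are integral, and on each edge of \<open>M\<close> their coordinates sum to 1, so they are
  characteristic vectors of covers of size \<open>card M\<close>. Thus every vertex lies in a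
  minimum cover, and removing it there covers the clutter with the vertex deleted.\<close>

text \<open>Column \<open>j\<close> of the matrix is the indicator of the indices that
  \<open>x\<close> sends into \<open>f j\<close>, so each covering inequality becomes a sum over a
  preimage under \<open>x\<close>.\<close>

lemma mem_set_covering_polyhedron_incidence_matrix:
  "w \<in> set_covering_polyhedron (incidence_matrix x f) \<longleftrightarrow>
     (\<forall>i. 0 \<le> w $ i) \<and> (\<forall>j. 1 \<le> (\<Sum>i\<in>x -` f j. w $ i))"
proof -
  have "(w v* incidence_matrix x f) $ j = (\<Sum>i\<in>x -` f j. w $ i)" for j
    unfolding vector_matrix_mult_def incidence_matrix_def
    by (simp add: if_distrib if_distribR vimage_def flip: sum.inter_filter cong: if_cong)
  then show ?thesis
    by (simp add: set_covering_polyhedron_def less_eq_vec_def)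
qed

lemma set_covering_polyhedron_incidence_matrix_eq:
  "set_covering_polyhedron (incidence_matrix x f) =
     (\<Inter>i. {w. 0 \<le> w $ i}) \<inter> (\<Inter>j. {w. 1 \<le> (\<Sum>i\<in>x -` f j. w $ i)})"
  by (auto simp: mem_set_covering_polyhedron_incidence_matrix)

lemma closed_set_covering_polyhedron_incidence_matrix:
  "closed (set_covering_polyhedron (incidence_matrix x f))"
  unfolding set_covering_polyhedron_incidence_matrix_eq
  by (intro closed_Int closed_INT ballI closed_Collect_le continuous_intros)

lemma convex_set_covering_polyhedron_incidence_matrix:
  fixes x :: "'n::finite \<Rightarrow> 'a" and f :: "'q::finite \<Rightarrow> 'a set"
  shows "convex (set_covering_polyhedron (incidence_matrix x f))"
proof (rule convexI)
  fix u w :: "real ^ 'n" and s t :: real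
  assume u: "u \<in> set_covering_polyhedron (incidence_matrix x f)"
    and w: "w \<in> set_covering_polyhedron (incidence_matrix x f)"
    and st: "0 \<le> s" "0 \<le> t" "s + t = 1"
  have "1 \<le> s * (\<Sum>i\<in>x -` f j. u $ i) + t * (\<Sum>i\<in>x -` f j. w $ i)" for j
  proof -
    have "s * 1 + t * 1 \<le> s * (\<Sum>i\<in>x -` f j. u $ i) + t * (\<Sum>i\<in>x -` f j. w $ i)"
      using u w st by (intro add_mono mult_left_mono)
        (auto simp: mem_set_covering_polyhedron_incidence_matrix)
    then show ?thesis using st by simp
  qed
  then show "s *\<^sub>R u + t *\<^sub>R w \<in> set_covering_polyhedron (incidence_matrix x f)"
    using u w st
    by (simp add: mem_set_covering_polyhedron_incidence_matrix sum.distrib flip: sum_distrib_left)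
qed

text \<open>Preimages of disjoint edges are disjoint, and those of the edges of \<open>M\<close>
  exhaust the index type because \<open>x\<close> takes its values in the union of
  \<open>M\<close>.\<close>

lemma sum_perfect_matching:
  fixes x :: "'n::finite \<Rightarrow> 'a" and w :: "'n \<Rightarrow> real"
  assumes "perfect_matching C M" and "finite M" and "bij_betw x UNIV (verts C)"
  shows "sum w UNIV = (\<Sum>e\<in>M. sum w (x -` e))"
proof -
  have "(\<Union>e\<in>M. x -` e) = UNIV"
    using assms unfolding perfect_matching_def bij_betw_def by blast
  moreover have "sum w (\<Union>e\<in>M. x -` e) = (\<Sum>e\<in>M. sum w (x -` e))"
    using assms unfolding perfect_matching_def pairwise_def disjnt_def
    by (intro sum.UNION_disjoint) (simp_all, blast)
  ultimately show ?thesis by simp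
qed

text \<open>Picking a point of \<open>U\<close> in each edge of \<open>M\<close> is injective, as
  distinct edges of \<open>M\<close> are disjoint. Finiteness of \<open>U\<close> matters because
  \<open>card\<close> is 0 on infinite sets.\<close>

lemma card_perfect_matching_le_cover:
  assumes "clutter C" and "perfect_matching C M" and "vertex_cover C U"
  shows "card M \<le> card U"
proof -
  have "\<forall>e\<in>M. \<exists>u. u \<in> U \<inter> e"
    using assms(2,3) unfolding perfect_matching_def vertex_cover_def by (meson ex_in_conv subsetD)
  then obtain h where h: "\<And>e. e \<in> M \<Longrightarrow> h e \<in> U \<inter> e" by metis
  have "inj_on h M"
  proof (rule inj_onI)
    fix e e' assume "e \<in> M" "e' \<in> M" "h e = h e'"
    then show "e = e'"
      using h[of e] h[of e'] assms(2)
      unfolding perfect_matching_def pairwise_def disjnt_def by auto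
  qed
  moreover have "h ` M \<subseteq> U" using h by blast
  moreover have "finite U"
    using assms unfolding clutter_def vertex_cover_def by (meson finite_subset)
  ultimately show ?thesis by (rule card_inj_on_le)
qed

text \<open>The witness \<open>V\<close> makes the set under \<open>LEAST\<close> nonempty;
  otherwise its value would be unspecified.\<close>

lemma cover_number_attained:
  assumes "vertex_cover C V"
  obtains U where "vertex_cover C U" "card U = cover_number C"
  using LeastI[of "\<lambda>k. \<exists>U. vertex_cover C U \<and> card U = k", OF exI[of _ V]] assms
  unfolding cover_number_def by blast

lemma cover_number_le:
  "vertex_cover C U \<Longrightarrow> cover_number C \<le> card U"
  unfolding cover_number_def by (rule Least_le) blast

theorem proposition2p1p6:
  fixes C :: "'a hypergraph" and d :: nat
    and x :: "'n::finite \<Rightarrow> 'a" and f :: "'q::finite \<Rightarrow> 'a set"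
  assumes "clutter C"
    and "d \<ge> 1"
    and "uniform d C"
    and "\<nexists>v. isolated C v"
    and "bij_betw x UNIV (verts C)"
    and "bij_betw f UNIV (edges C)"
    and "\<exists>M. perfect_matching C M"
    and "integral_polyhedron (set_covering_polyhedron (incidence_matrix x f))"
  shows "vertex_critical C"
  unfolding vertex_critical_def
proof
  fix p assume p: "p \<in> verts C"
  obtain M where M: "perfect_matching C M" using assms by blast
  obtain k where k: "x k = p" using p assms(5) unfolding bij_betw_def by (metis imageE)
  have injx: "inj x" and rangex: "range x = verts C"
    using assms(5) unfolding bij_betw_def by auto
  have rangef: "range f = edges C" using assms(6) unfolding bij_betw_def by auto
  have finM: "finite M"
    using M finite_subset[of M "range f"] by (simp add: perfect_matching_def flip: rangef)
  have sumM: "sum (($) w) UNIV = (\<Sum>e\<in>M. sum (($) w) (x -` e))" for w :: "real ^ 'n"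
    using sum_perfect_matching[OF M finM assms(5)] .
  define Q where "Q = set_covering_polyhedron (incidence_matrix x f)"
  have Q_nonneg: "0 \<le> w $ i" if "w \<in> Q" for w i
    using that by (simp add: Q_def mem_set_covering_polyhedron_incidence_matrix)
  have Q_edge: "1 \<le> (\<Sum>i\<in>x -` e. w $ i)" if "w \<in> Q" "e \<in> edges C" for w e
    using that by (auto simp: Q_def mem_set_covering_polyhedron_incidence_matrix simp flip: rangef)
  have Q_edgeM: "1 \<le> (\<Sum>i\<in>x -` e. w $ i)" if "w \<in> Q" "e \<in> M" for w e
    using that Q_edge M unfolding perfect_matching_def by blast
  have sum_ge: "real (card M) \<le> sum (($) w) UNIV" if "w \<in> Q" for w
    using sum_mono[OF Q_edgeM[OF that]] by (simp add: sumM)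
  \<comment> \<open>By \<open>sum_ge\<close> this hyperplane supports \<open>Q\<close>; the inner
    product form is the one that the face criterion expects.\<close>
  define F where "F = Q \<inter> {w. 1 \<bullet> w = real (card M)}"
  have F_iff: "w \<in> F \<longleftrightarrow> w \<in> Q \<and> sum (($) w) UNIV = real (card M)" for w
    by (simp add: F_def inner_vec_def)
  have face: "F face_of Q"
    unfolding F_def
    using convex_set_covering_polyhedron_incidence_matrix sum_ge
    by (intro face_of_Int_supporting_hyperplane_ge) (auto simp: Q_def inner_vec_def)
  have "compact F"
  proof -
    have "closed F"
      unfolding F_def Q_def
      by (intro closed_Int closed_set_covering_polyhedron_incidence_matrix closed_hyperplane)
    \<comment> \<open>On nonnegative vectors the l1 norm is the coordinate sum, which is constant on
      \<open>F\<close>.\<close>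
    moreover have "bounded F"
      unfolding bounded_iff
    proof (intro exI ballI)
      fix w assume w: "w \<in> F"
      have "norm w \<le> (\<Sum>i\<in>UNIV. \<bar>w $ i\<bar>)" by (rule norm_le_l1_cart)
      also have "\<dots> = sum (($) w) UNIV"
        using w Q_nonneg by (intro sum.cong) (auto simp: F_iff)
      finally show "norm w \<le> real (card M)" using w by (simp add: F_iff)
    qed
    ultimately show ?thesis by (simp add: compact_eq_bounded_closed)
  qed
  \<comment> \<open>Compactness is the reason for passing to \<open>F\<close>: \<open>Q\<close> is
    unbounded and is not the hull of its extreme points.\<close>
  then have hull: "F = convex hull {v. v extreme_point_of F}"
    using face face_of_imp_convex convex_set_covering_polyhedron_incidence_matrix
    by (intro Krein_Milman_Minkowski) (auto simp: Q_def)
  define c :: "real ^ 'n" where "c = (\<chi> i. 1 / real d)"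
  have c_edge: "sum (($) c) (x -` e) = 1" if "e \<in> edges C" for e
  proof -
    have "card (x -` e) = card e"
      using that assms(1) rangex injx by (intro card_vimage_inj) (auto simp: clutter_def)
    then show ?thesis using that assms(2,3) by (simp add: c_def uniform_def)
  qed
  have "c \<in> Q"
    unfolding Q_def mem_set_covering_polyhedron_incidence_matrix
  proof (intro conjI allI)
    show "0 \<le> c $ i" for i by (simp add: c_def)
    show "1 \<le> sum (($) c) (x -` f j)" for j
      using c_edge[of "f j"] by (simp flip: rangef)
  qed
  moreover have "sum (($) c) UNIV = real (card M)"
    using c_edge M unfolding sumM by (simp add: perfect_matching_def subset_iff)
  ultimately have "c \<in> F" by (simp add: F_iff)
  obtain v where v: "v extreme_point_of F" and vk: "v $ k \<noteq> 0"
  proof (rule ccontr)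
    assume "\<not> thesis"
    then have "{v. v extreme_point_of F} \<subseteq> {v. v $ k = 0}" using that by blast
    moreover have "convex {v :: real ^ 'n. v $ k = 0}"
      by (auto simp: convex_def)
    ultimately have "convex hull {v. v extreme_point_of F} \<subseteq> {v. v $ k = 0}"
      by (rule hull_minimal)
    then have "F \<subseteq> {v. v $ k = 0}" using hull by blast
    with \<open>c \<in> F\<close> have "c $ k = 0" by blast
    then show False using assms(2) by (simp add: c_def)
  qed
  have vF: "v \<in> F" using v by (simp add: extreme_point_of_def)
  then have vQ: "v \<in> Q" by (simp add: F_iff)
  \<comment> \<open>Extreme points of a face of \<open>Q\<close> are extreme points of
    \<open>Q\<close>, where integrality applies.\<close>
  have v_Ints: "v $ i \<in> \<int>" for i
    using v assms(8) extreme_point_of_face[OF face]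
    unfolding integral_polyhedron_def Q_def by blast
  \<comment> \<open>Each of the \<open>card M\<close> edge sums is at least 1 and they total
    \<open>card M\<close>, so none can exceed 1.\<close>
  have v_edge: "sum (($) v) (x -` e) = 1" if "e \<in> M" for e
  proof (rule ccontr)
    assume "sum (($) v) (x -` e) \<noteq> 1"
    then have "(\<Sum>e\<in>M. 1) < (\<Sum>e\<in>M. sum (($) v) (x -` e))"
      using Q_edgeM[OF vQ] that finM by (intro sum_strict_mono_ex1) (auto simp: order_less_le)
    then show False using vF by (simp add: F_iff flip: sumM)
  qed
  have v01: "v $ i = 0 \<or> v $ i = 1" for i
  proof -
    obtain e where e: "e \<in> M" "x i \<in> e"
      using M rangeI[of x i] unfolding perfect_matching_def rangex by (metis Union_iff)
    then have "v $ i \<le> sum (($) v) (x -` e)"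
      using Q_nonneg[OF vQ] by (intro member_le_sum) auto
    then have "0 \<le> v $ i" "v $ i \<le> 1" using e v_edge Q_nonneg[OF vQ] by auto
    moreover obtain z where "v $ i = of_int z" using v_Ints[of i] by (auto elim: Ints_cases)
    ultimately show ?thesis by (cases "z = 0"; cases "z = 1") auto
  qed
  define S where "S = {i. v $ i = 1}"
  have kS: "k \<in> S" using vk v01 by (auto simp: S_def)
  have cardS: "card S = card M"
  proof -
    have "sum (($) v) UNIV = (\<Sum>i\<in>UNIV. if i \<in> S then 1 else 0)"
      using v01 by (intro sum.cong) (auto simp: S_def)
    also have "\<dots> = real (card S)" by (simp add: sum.If_cases)
    finally show ?thesis using vF by (simp add: F_iff)
  qed
  \<comment> \<open>An edge missed by the image of \<open>S\<close> would have weight 0 under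
    \<open>v\<close>, against its covering inequality.\<close>
  have S_edge: "x ` S \<inter> e \<noteq> {}" if "e \<in> edges C" for e
  proof
    assume "x ` S \<inter> e = {}"
    then have "v $ i = 0" if "i \<in> x -` e" for i using that v01[of i] by (auto simp: S_def)
    then show False using Q_edge[OF vQ that] by simp
  qed
  have "x ` (S - {k}) = x ` S - {p}"
    using injx k by (auto simp: inj_eq)
  moreover have "x ` S \<subseteq> verts C" using rangex by blast
  \<comment> \<open>The edges surviving the deletion avoid \<open>p\<close>, so \<open>p\<close>
    never serves to cover them.\<close>
  moreover have "(x ` S - {p}) \<inter> e \<noteq> {}" if "e \<in> edges C" "p \<notin> e" for e
    using S_edge[OF that(1)] that(2) by blast
  ultimately have "vertex_cover (delete_vertex C p) (x ` (S - {k}))"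
    by (auto simp: vertex_cover_def delete_vertex_def)
  then have "cover_number (delete_vertex C p) \<le> card (x ` (S - {k}))" by (rule cover_number_le)
  also have "\<dots> = card (S - {k})"
    using injx by (intro card_image) (auto intro: inj_on_subset)
  also have "\<dots> < card M" using kS cardS by (metis card_Diff1_less finite)
  also have "card M \<le> cover_number C"
  proof -
    \<comment> \<open>This cover only guarantees that a minimum one exists; the bound comes from the
      matching.\<close>
    have "vertex_cover C (x ` S)" using S_edge rangex by (auto simp: vertex_cover_def)
    then obtain U where "vertex_cover C U" "card U = cover_number C" by (rule cover_number_attained)
    then show ?thesis using card_perfect_matching_le_cover[OF assms(1) M] by metis
  qed
  finally show "cover_number (delete_vertex C p) < cover_number C" .
qed

end
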